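(* Let $G=(V,E)$ be a finite, connected graph. Then for every $u,v\in V$ and every $p$ with $1-2^{-|E|/2-2}\leqslant p<1$, \[ \mathbb{P}^{\mathrm{bb}}_p\big((u,0)\leftrightarrow (v,0)\big) \;>\; \mathbb{P}^{\mathrm{bb}}_p\big((u,0)\leftrightarrow (v,1)\big). \]
   Context: Graphs are allowed to contain self-loops and multiple edges. The bunkbed graph of $G=(V,E)$ is the Cartesian product $G\times K_2$: its vertex set is $V\times\{0,1\}$; for every edge $e$ of $G$ with endpoints $x,y$ there are two "horizontal" edges, one joining $(x,0)$ to $(y,0)$ and one joining $(x,1)$ to $(y,1)$; and for every $w\in V$ there is one "vertical" edge joining $(w,0)$ and $(w,1)$. $\mathbb{P}^{\mathrm{bb}}_p$ denotes the law of Bernoulli bond percolation with parameter $p$ on $G\times K_2$: each edge is independently open with probability $p$ and closed otherwise, and $a\leftrightarrow b$ denotes the event that $a$ and $b$ are joined by a path of open edges. *)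

theory Defs
  imports "HOL-Probability.Probability" "HOL-Library.Uprod"
begin

(* Undirected multigraphs: the edges are labels, and each label carries an unordered pair of
   end vertices. Distinct labels may carry the same pair (multiple edges), and the pair
   Upair x x is a self-loop. *)
record ('v, 'e) mgraph =
  verts :: "'v set"
  edges :: "'e set"
  ends :: "'e \<Rightarrow> 'v uprod"

definition multigraph :: "('v, 'e) mgraph \<Rightarrow> bool" where
  "multigraph G \<longleftrightarrow> (\<forall>e\<in>edges G. set_uprod (ends G e) \<subseteq> verts G)"

definition finite_graph :: "('v, 'e) mgraph \<Rightarrow> bool" where
  "finite_graph G \<longleftrightarrow> finite (verts G) \<and> finite (edges G)"

(* A set of pairs of vertices, in both orders; S selects the edges that may be used. *)
definition adjacency :: "('v, 'e) mgraph \<Rightarrow> 'e set \<Rightarrow> ('v \<times> 'v) set" where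
  "adjacency G S = {(x, y). \<exists>e \<in> edges G \<inter> S. ends G e = Upair x y}"

(* x and y are joined by a (possibly empty) path all of whose edges lie in S. *)
definition joined :: "('v, 'e) mgraph \<Rightarrow> 'e set \<Rightarrow> 'v \<Rightarrow> 'v \<Rightarrow> bool" where
  "joined G S x y \<longleftrightarrow> x \<in> verts G \<and> y \<in> verts G \<and> (x, y) \<in> (adjacency G S)\<^sup>*"

definition connected_graph :: "('v, 'e) mgraph \<Rightarrow> bool" where
  "connected_graph G \<longleftrightarrow>
     verts G \<noteq> {} \<and> (\<forall>x\<in>verts G. \<forall>y\<in>verts G. joined G (edges G) x y)"

datatype ('v, 'e) bb_edge = Horizontal 'e nat | Vertical 'v

definition bunkbed :: "('v, 'e) mgraph \<Rightarrow> ('v \<times> nat, ('v, 'e) bb_edge) mgraph" where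
  "bunkbed G =
     \<lparr> verts = verts G \<times> {0, 1},
       edges = {Horizontal e i | e i. e \<in> edges G \<and> i \<in> {0, 1}} \<union> {Vertical w | w. w \<in> verts G},
       ends = (\<lambda>b. case b of
                 Horizontal e i \<Rightarrow> map_uprod (\<lambda>x. (x, i)) (ends G e)
               | Vertical w \<Rightarrow> Upair (w, 0) (w, 1)) \<rparr>"

(* Bernoulli bond percolation on a finite graph. A configuration maps each edge to True (open)
   or False (closed); the constant False outside the edge set only pads the function type. *)
definition percolation :: "('v, 'e) mgraph \<Rightarrow> real \<Rightarrow> ('e \<Rightarrow> bool) pmf" where
  "percolation G p = Pi_pmf (edges G) False (\<lambda>_. bernoulli_pmf p)"

definition connection_event :: "('v, 'e) mgraph \<Rightarrow> 'v \<Rightarrow> 'v \<Rightarrow> ('e \<Rightarrow> bool) set" where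
  "connection_event G a b = {\<omega>. joined G {e. \<omega> e} a b}"

definition bunkbed_prob :: "('v, 'e) mgraph \<Rightarrow> real \<Rightarrow> 'v \<times> nat \<Rightarrow> 'v \<times> nat \<Rightarrow> real" where
  "bunkbed_prob G p a b =
     measure_pmf.prob (percolation (bunkbed G) p) (connection_event (bunkbed G) a b)"

end

theory Submission
  imports Defs
begin

text \<open>
  Write a configuration as the set S of open edges, and let A be the event that (u,0) is joined to
  (v,1) but not to (v,0), and B the event with the roles of (v,0) and (v,1) exchanged; the claim is
  that B is more likely than A. Call a vertex of G posted if paths of edges open on both levels
  join it to an open vertical edge, and let the region X of S be the set of vertices reachable
  from v by edges open on at least one level, while avoiding posted vertices. Neither X nor the set
  of posted vertices changes if the two levels of some edges are swapped.

  If u lies outside X, swapping the levels of all edges that touch X is a measure preserving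
  bijection between A and B, since X can only be left to posted vertices. If u lies in X and all
  edges inside X are open on level 0, then A fails; if they are all open on level 1, swapping all
  levels maps A into the part of B where they are all open on level 0 but not on level 1. In the
  remaining case some edge inside X is closed on each level. Opening all edges inside X on both
  levels, and moving all open boundary edges of X to level 0, yields a configuration in B. If X
  has m inside edges and b boundary edges, a fibre of this map has relative weight at most
  2^b (1 - p^m)^2 / p^(2m), which the assumption on p makes at most 1/2.
\<close>

section \<open>Weights of sets of open edges\<close>

definition bernoulli_weight :: "real \<Rightarrow> 'a set \<Rightarrow> 'a set \<Rightarrow> real" where
  "bernoulli_weight p A S = (\<Prod>b\<in>A. if b \<in> S then p else 1 - p)"

lemma bernoulli_weight_nonneg: "0 \<le> p \<Longrightarrow> p \<le> 1 \<Longrightarrow> 0 \<le> bernoulli_weight p A S"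
  unfolding bernoulli_weight_def by (intro prod_nonneg) auto

lemma bernoulli_weight_pos: "0 < p \<Longrightarrow> p < 1 \<Longrightarrow> 0 < bernoulli_weight p A S"
  unfolding bernoulli_weight_def by (intro prod_pos) auto

lemma bernoulli_weight_all: "bernoulli_weight p A A = p ^ card A"
  unfolding bernoulli_weight_def by simp

lemma sum_bernoulli_weight:
  assumes "finite A"
  shows "(\<Sum>S\<in>Pow A. bernoulli_weight p A S) = 1"
proof -
  have "bernoulli_weight p A S = (\<Prod>x\<in>S. p) * (\<Prod>x\<in>A - S. 1 - p)" if "S \<in> Pow A" for S
  proof -
    have "S \<subseteq> A" using that by simp
    have "bernoulli_weight p A S
        = (\<Prod>b\<in>A - S. if b \<in> S then p else 1 - p) * (\<Prod>b\<in>S. if b \<in> S then p else 1 - p)"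
      unfolding bernoulli_weight_def
      by (rule prod.subset_diff[OF \<open>S \<subseteq> A\<close> assms])
    then show ?thesis by simp
  qed
  then have "(\<Sum>S\<in>Pow A. bernoulli_weight p A S)
      = (\<Sum>S\<in>Pow A. (\<Prod>x\<in>S. p) * (\<Prod>x\<in>A - S. 1 - p))"
    by (rule sum.cong[OF refl])
  also have "\<dots> = (\<Prod>x\<in>A. p + (1 - p))"
    by (rule prod_add[OF assms, symmetric])
  finally show ?thesis by simp
qed

lemma sum_bernoulli_weight_not_all:
  assumes "finite A"
  shows "(\<Sum>S\<in>Pow A - {A}. bernoulli_weight p A S) = 1 - p ^ card A"
  using sum.remove[of "Pow A" A "bernoulli_weight p A"] sum_bernoulli_weight[OF assms, of p] assms
  by (simp add: bernoulli_weight_all)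

text \<open>Almost surely a configuration is \<open>False\<close> outside \<open>A\<close>, hence
  the indicator of a subset of \<open>A\<close>. From here on probabilities are finite sums over
  sets of open edges.\<close>

lemma prob_Pi_bernoulli:
  assumes A: "finite A" and p: "0 \<le> p" "p \<le> 1"
  shows "measure_pmf.prob (Pi_pmf A False (\<lambda>_. bernoulli_pmf p)) {\<omega>. P {e. \<omega> e}}
       = (\<Sum>S | S \<in> Pow A \<and> P S. bernoulli_weight p A S)"
proof -
  let ?M = "Pi_pmf A False (\<lambda>_. bernoulli_pmf p)"
  let ?T = "{S. S \<in> Pow A \<and> P S}"
  let ?f = "\<lambda>S e. e \<in> S"
  have fin: "finite ?T" using A by simp
  have "set_pmf ?M \<subseteq> {f. \<forall>x. x \<notin> A \<longrightarrow> f x = False}"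
    by (rule set_Pi_pmf_subset[OF A])
  then have eq: "{\<omega>. P {e. \<omega> e}} \<inter> set_pmf ?M = ?f ` ?T \<inter> set_pmf ?M"
  proof (intro equalityI subsetI)
    fix \<omega> assume "\<omega> \<in> {\<omega>. P {e. \<omega> e}} \<inter> set_pmf ?M"
    moreover from this have "{e. \<omega> e} \<subseteq> A"
      using \<open>set_pmf ?M \<subseteq> _\<close> by auto
    moreover have "\<omega> = ?f {e. \<omega> e}" by simp
    ultimately show "\<omega> \<in> ?f ` ?T \<inter> set_pmf ?M" by blast
  qed auto
  have "measure_pmf.prob ?M {\<omega>. P {e. \<omega> e}} = measure_pmf.prob ?M (?f ` ?T)"
    by (metis eq measure_Int_set_pmf)
  also have "\<dots> = (\<Sum>\<omega>\<in>?f ` ?T. pmf ?M \<omega>)"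
    using fin by (intro measure_measure_pmf_finite) simp
  also have "\<dots> = (\<Sum>S\<in>?T. pmf ?M (?f S))"
    by (subst sum.reindex) (auto simp: inj_on_def fun_eq_iff)
  also have "\<dots> = (\<Sum>S\<in>?T. bernoulli_weight p A S)"
  proof (rule sum.cong[OF refl])
    fix S assume "S \<in> ?T"
    then have "pmf ?M (?f S) = (\<Prod>x\<in>A. pmf (bernoulli_pmf p) (x \<in> S))"
      by (intro pmf_Pi' A) auto
    also have "\<dots> = bernoulli_weight p A S"
      unfolding bernoulli_weight_def using p by (intro prod.cong) auto
    finally show "pmf ?M (?f S) = bernoulli_weight p A S" .
  qed
  finally show ?thesis .
qed

section \<open>The numerical estimate behind the bound on p\<close>

text \<open>The factor 2 accommodates \<open>n = 3\<close>, where 9 exceeds 8; from 4 on, induction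
  gives the bound without it.\<close>

lemma square_le_two_powers: "n ^ 2 \<le> 2 * 2 ^ (n::nat)"
proof (cases "n < 4")
  case True
  then have "n \<in> {0, 1, 2, 3}" by auto
  then show ?thesis by auto
next
  case False
  then have "4 \<le> n" by simp
  then have "n ^ 2 \<le> 2 ^ n"
  proof (induction n rule: dec_induct)
    case (step k)
    have "4 * k \<le> k * k" using step by simp
    then have "2 * k + 1 \<le> k * k" using step(1) by linarith
    then have "(Suc k)^2 \<le> 2 * k^2" by (simp add: power2_eq_square)
    then show ?case using step by simp
  qed simp
  then show ?thesis by simp
qed

text \<open>For \<open>q = 1 - p\<close> the lower bound on \<open>p\<close> gives
  \<open>q\<^sup>2 * 2 ^ n \<le> 1 / 16\<close>. Bernoulli's inequality bounds
  \<open>1 - p ^ m\<close> by \<open>m * q\<close>, and \<open>m\<^sup>2 \<le> 2 * 2 ^ m\<close>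
  then brings \<open>2 ^ b * (1 - p ^ m)\<^sup>2\<close> down to at most 1/8. In particular
  \<open>p ^ m\<close> is at least 1/2, so its square is at least 1/4.\<close>

lemma fibre_constant:
  fixes p :: real and m b n :: nat
  assumes p: "1 - 2 powr (- real n / 2 - 2) \<le> p" "p < 1" and n: "m + b \<le> n"
  shows "2 * (2 ^ b * (1 - p ^ m)\<^sup>2) \<le> (p ^ m)\<^sup>2"
proof -
  define q where "q = 1 - p"
  have q0: "0 < q" using p by (simp add: q_def)
  have "q \<le> 2 powr (- real n / 2 - 2)" using p by (simp add: q_def)
  then have "q\<^sup>2 \<le> (2 powr (- real n / 2 - 2))\<^sup>2" using q0 by (intro power_mono) auto
  also have "\<dots> = 2 powr (- real n - 4)"
    by (simp add: power2_eq_square powr_add[symmetric])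
  also have "\<dots> = 1 / (16 * 2 ^ n)"
    by (simp add: powr_diff powr_minus powr_realpow field_simps)
  finally have q2: "q\<^sup>2 * 2 ^ n \<le> 1 / 16" by (simp add: field_simps)
  \<comment> \<open>The crude bound \<open>q \<le> 1/4\<close> supplies the side condition of
    Bernoulli's inequality and the sign of \<open>p\<close>.\<close>
  have "q\<^sup>2 * 1 \<le> q\<^sup>2 * 2 ^ n" by (intro mult_left_mono) auto
  then have "q\<^sup>2 \<le> (1/4)\<^sup>2" using q2 by (simp add: power2_eq_square)
  then have q1: "q \<le> 1/4" by (rule power2_le_imp_le) simp
  define x where "x = 1 - p ^ m"
  have "1 - real m * q \<le> p ^ m"
    using Bernoulli_inequality[of "-q" m] q1 by (simp add: q_def algebra_simps)
  then have x1: "x \<le> real m * q" by (simp add: x_def)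
  have x0: "0 \<le> x" using q1 p by (simp add: x_def q_def power_le_one)
  have "2 ^ b * x\<^sup>2 \<le> 2 ^ b * (real m * q)\<^sup>2" using x0 x1 by (intro mult_left_mono power_mono) auto
  also have "\<dots> = 2 ^ b * (real m)\<^sup>2 * q\<^sup>2" by (simp add: power_mult_distrib)
  also have "\<dots> \<le> 2 ^ b * (2 * 2 ^ m) * q\<^sup>2"
  proof -
    have "real (m\<^sup>2) \<le> real (2 * 2 ^ m)" using square_le_two_powers by (simp only: of_nat_le_iff)
    then show ?thesis by (intro mult_right_mono mult_left_mono) auto
  qed
  also have "\<dots> = 2 * (2 ^ (m + b) * q\<^sup>2)" by (simp add: power_add)
  also have "\<dots> \<le> 2 * (2 ^ n * q\<^sup>2)"
    using n by (intro mult_left_mono mult_right_mono power_increasing) auto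
  also have "\<dots> \<le> 1 / 8" using q2 by (simp add: mult.commute)
  finally have bx: "2 ^ b * x\<^sup>2 \<le> 1 / 8" .
  have "1 * x\<^sup>2 \<le> 2 ^ b * x\<^sup>2" by (intro mult_right_mono) auto
  then have "x\<^sup>2 \<le> (1/2)\<^sup>2" using bx by (simp add: power2_eq_square)
  then have "x \<le> 1/2" by (rule power2_le_imp_le) simp
  then have "(1/2)\<^sup>2 \<le> (1 - x)\<^sup>2" by (intro power_mono) auto
  then show ?thesis using bx by (simp add: x_def power2_eq_square)
qed

lemma sum_le_sum_inj:
  fixes w :: "'a \<Rightarrow> real"
  assumes "inj_on f A" "f ` A \<subseteq> B" "finite B" "\<And>x. x \<in> A \<Longrightarrow> w (f x) = w x" "\<And>x. 0 \<le> w x"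
  shows "sum w A \<le> sum w B"
proof -
  have "sum w A = sum w (f ` A)" using assms by (simp add: sum.reindex)
  also have "\<dots> \<le> sum w B" using assms by (intro sum_mono2) auto
  finally show ?thesis .
qed

section \<open>The bunkbed graph, posted vertices and regions\<close>

text \<open>The root is the target vertex of the theorem, from which regions are grown; the start
  vertex stays a variable of the lemmas.\<close>

locale rooted_graph =
  fixes G :: "('v, 'e) mgraph" and v :: 'v
  assumes multigraph: "multigraph G" and finite_graph: "finite_graph G"
    and connected: "connected_graph G" and root: "v \<in> verts G"
begin

abbreviation bb_edges :: "('v, 'e) bb_edge set" where
  "bb_edges \<equiv> edges (bunkbed G)"

definition linked :: "('v, 'e) bb_edge set \<Rightarrow> ('v \<times> nat) rel" where
  "linked S = (adjacency (bunkbed G) S)\<^sup>*"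

definition doubly :: "('v, 'e) bb_edge set \<Rightarrow> 'e set" where
  "doubly S = {e. Horizontal e 0 \<in> S \<and> Horizontal e 1 \<in> S}"

definition singly :: "('v, 'e) bb_edge set \<Rightarrow> 'e set" where
  "singly S = {e. Horizontal e 0 \<in> S \<or> Horizontal e 1 \<in> S}"

text \<open>Vertices whose two copies are joined by a path that is invariant under swapping levels.\<close>

definition posted :: "('v, 'e) bb_edge set \<Rightarrow> 'v set" where
  "posted S = {x. \<exists>w. Vertical w \<in> S \<and> (x, w) \<in> (adjacency G (doubly S))\<^sup>*}"

text \<open>The conjunct on \<open>v\<close> makes the region empty when \<open>v\<close> is posted;
  the reflexive closure alone would still contain \<open>v\<close>.\<close>

definition region :: "('v, 'e) bb_edge set \<Rightarrow> 'v set" where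
  "region S = {x. v \<notin> posted S \<and> (v, x) \<in> (Restr (adjacency G (singly S)) (- posted S))\<^sup>*}"

definition inner_edges :: "'v set \<Rightarrow> 'e set" where
  "inner_edges X = {e \<in> edges G. set_uprod (ends G e) \<subseteq> X}"

definition touching :: "'v set \<Rightarrow> 'e set" where
  "touching X = {e \<in> edges G. set_uprod (ends G e) \<inter> X \<noteq> {}}"

definition rim_edges :: "'v set \<Rightarrow> 'e set" where
  "rim_edges X = touching X - inner_edges X"

text \<open>Subtraction on naturals makes \<open>1 - i\<close> an involution on the levels 0 and 1
  only, which is why \<open>flip_conf\<close> is cut down to \<open>bb_edges\<close>.\<close>

definition flip :: "'v set \<Rightarrow> ('v, 'e) bb_edge \<Rightarrow> ('v, 'e) bb_edge" where
  "flip X b = (case b of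
     Horizontal e i \<Rightarrow> Horizontal e (if e \<in> touching X then 1 - i else i)
   | Vertical w \<Rightarrow> Vertical w)"

definition flip_conf :: "'v set \<Rightarrow> ('v, 'e) bb_edge set \<Rightarrow> ('v, 'e) bb_edge set" where
  "flip_conf X S = {b \<in> bb_edges. flip X b \<in> S}"

definition flip_vertex :: "'v set \<Rightarrow> 'v \<times> nat \<Rightarrow> 'v \<times> nat" where
  "flip_vertex X = (\<lambda>(x, i). (x, if x \<in> X then 1 - i else i))"

lemma flip_simps [simp]:
  "flip X (Horizontal e i) = Horizontal e (if e \<in> touching X then 1 - i else i)"
  "flip X (Vertical w) = Vertical w"
  by (simp_all add: flip_def)

lemma bb_edges_iff [simp]:
  "Horizontal e i \<in> bb_edges \<longleftrightarrow> e \<in> edges G \<and> (i = 0 \<or> i = 1)"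
  "Vertical w \<in> bb_edges \<longleftrightarrow> w \<in> verts G"
  by (auto simp: bunkbed_def)

lemma finite_bb_edges: "finite bb_edges"
proof -
  have "bb_edges = (\<lambda>(e, i). Horizontal e i) ` (edges G \<times> {0, 1}) \<union> Vertical ` verts G"
    by (auto simp: bunkbed_def)
  then show ?thesis using finite_graph by (simp add: finite_graph_def)
qed

lemma ends_bunkbed:
  "ends (bunkbed G) (Horizontal e i) = map_uprod (\<lambda>x. (x, i)) (ends G e)"
  "ends (bunkbed G) (Vertical w) = Upair (w, 0) (w, 1)"
  by (simp_all add: bunkbed_def)

lemma adjacency_bunkbed_iff:
  "((x, i), (y, j)) \<in> adjacency (bunkbed G) S \<longleftrightarrow>
     (i = j \<and> i \<in> {0, 1} \<and> (\<exists>e\<in>edges G. Horizontal e i \<in> S \<and> ends G e = Upair x y)) \<or>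
     (x = y \<and> x \<in> verts G \<and> Vertical x \<in> S \<and> (i, j) \<in> {(0, 1), (1, 0)})"
(is "?l \<longleftrightarrow> ?h \<or> ?v")
proof
  assume ?l
  then obtain b where b: "b \<in> bb_edges" "b \<in> S" "ends (bunkbed G) b = Upair (x, i) (y, j)"
    by (auto simp: adjacency_def)
  show "?h \<or> ?v"
  proof (cases b)
    case (Horizontal e k)
    obtain c d where cd: "ends G e = Upair c d" by (cases "ends G e")
    then show ?thesis using b Horizontal by (auto simp: ends_bunkbed)
  qed (use b in \<open>auto simp: ends_bunkbed\<close>)
next
  assume "?h \<or> ?v"
  then show ?l
  proof (elim disjE conjE bexE)
    fix e assume "i = j" "i \<in> {0, 1}" "e \<in> edges G" "Horizontal e i \<in> S" "ends G e = Upair x y"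
    then have "Horizontal e i \<in> bb_edges \<inter> S"
        "ends (bunkbed G) (Horizontal e i) = Upair (x, i) (y, j)"
      by (simp_all add: ends_bunkbed)
    then show ?l unfolding adjacency_def by blast
  next
    assume "x = y" "x \<in> verts G" "Vertical x \<in> S" "(i, j) \<in> {(0, 1), (1, 0)}"
    then have "Vertical x \<in> bb_edges \<inter> S"
        "ends (bunkbed G) (Vertical x) = Upair (x, i) (y, j)"
      by (auto simp: ends_bunkbed)
    then show ?l unfolding adjacency_def by blast
  qed
qed

lemma sym_adjacency:
  fixes H :: "('a, 'b) mgraph"
  shows "sym (adjacency H S)"
proof (rule symI)
  fix x y :: 'a
  have "Upair x y = Upair y x" by simp
  then show "(x, y) \<in> adjacency H S \<Longrightarrow> (y, x) \<in> adjacency H S"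
    by (simp add: adjacency_def)
qed

lemma linked_refl [simp]: "(a, a) \<in> linked S"
  by (simp add: linked_def)

lemma linked_sym: "(a, b) \<in> linked S \<Longrightarrow> (b, a) \<in> linked S"
  unfolding linked_def by (meson sym_adjacency sym_rtrancl symD)

lemma linked_trans: "(a, b) \<in> linked S \<Longrightarrow> (b, c) \<in> linked S \<Longrightarrow> (a, c) \<in> linked S"
  unfolding linked_def by (rule rtrancl_trans)

lemma linked_edge:
  "e \<in> edges G \<Longrightarrow> Horizontal e i \<in> S \<Longrightarrow> i \<in> {0, 1} \<Longrightarrow> ends G e = Upair x y \<Longrightarrow>
     ((x, i), (y, i)) \<in> linked S"
  unfolding linked_def by (rule r_into_rtrancl) (auto simp: adjacency_bunkbed_iff)

lemma linked_level:
  assumes "(x, y) \<in> (adjacency G F)\<^sup>*" "i \<in> {0, 1}" "\<And>e. e \<in> F \<inter> edges G \<Longrightarrow> Horizontal e i \<in> S"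
  shows "((x, i), (y, i)) \<in> linked S"
  using assms(1)
proof (induction rule: rtrancl_induct)
  case (step y z)
  then obtain e where "e \<in> edges G" "e \<in> F" "ends G e = Upair y z"
    by (auto simp: adjacency_def)
  then have "((y, i), (z, i)) \<in> linked S" using assms by (intro linked_edge) auto
  with step.IH show ?case by (rule linked_trans)
qed simp

text \<open>Walk along the doubly open path on level \<open>i\<close>, change level at the open
  vertical edge, and walk back on level \<open>j\<close>.\<close>

lemma linked_posted:
  assumes "x \<in> posted S" "S \<subseteq> bb_edges" "i \<in> {0, 1}" "j \<in> {0, 1}"
  shows "((x, i), (x, j)) \<in> linked S"
proof -
  obtain w where w: "Vertical w \<in> S" "(x, w) \<in> (adjacency G (doubly S))\<^sup>*"
    using assms by (auto simp: posted_def)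
  have l: "((x, k), (w, k)) \<in> linked S" if "k \<in> {0, 1}" for k
    using w(2) that by (rule linked_level) (use that in \<open>auto simp: doubly_def\<close>)
  have "w \<in> verts G" using w assms by auto
  then have "((w, i), (w, j)) \<in> linked S"
    using w assms(3,4) by (cases "i = j") (auto simp: linked_def adjacency_bunkbed_iff)
  then show ?thesis
    by (rule linked_trans[OF l[OF assms(3)] linked_trans[OF _ linked_sym[OF l[OF assms(4)]]]])
qed

section \<open>Swapping the levels\<close>

lemma flip_closed: "b \<in> bb_edges \<Longrightarrow> flip X b \<in> bb_edges"
  by (cases b) auto

lemma flip_flip: "b \<in> bb_edges \<Longrightarrow> flip X (flip X b) = b"
  by (cases b) auto

lemma flip_conf_subset: "flip_conf X S \<subseteq> bb_edges"
  by (auto simp: flip_conf_def)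

lemma flip_conf_flip_conf: "S \<subseteq> bb_edges \<Longrightarrow> flip_conf X (flip_conf X S) = S"
  unfolding flip_conf_def using flip_closed flip_flip by auto

lemma weight_flip_conf:
  assumes "S \<subseteq> bb_edges"
  shows "bernoulli_weight p bb_edges (flip_conf X S) = bernoulli_weight p bb_edges S"
  unfolding bernoulli_weight_def
  by (rule prod.reindex_bij_witness[of _ "flip X" "flip X"])
     (use flip_closed flip_flip in \<open>auto simp: flip_conf_def\<close>)

lemma doubly_flip_conf: "S \<subseteq> bb_edges \<Longrightarrow> doubly (flip_conf X S) = doubly S"
  by (auto simp: doubly_def flip_conf_def)

lemma singly_flip_conf: "S \<subseteq> bb_edges \<Longrightarrow> singly (flip_conf X S) = singly S"
  by (auto simp: singly_def flip_conf_def split: if_splits)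

lemma posted_flip_conf:
  assumes "S \<subseteq> bb_edges" shows "posted (flip_conf X S) = posted S"
proof -
  have "Vertical w \<in> flip_conf X S \<longleftrightarrow> Vertical w \<in> S" for w
    using assms by (auto simp: flip_conf_def)
  then show ?thesis by (simp add: posted_def doubly_flip_conf[OF assms])
qed

lemma region_flip_conf: "S \<subseteq> bb_edges \<Longrightarrow> region (flip_conf X S) = region S"
  by (simp add: region_def posted_flip_conf singly_flip_conf)

text \<open>Paths are mapped edge by edge. An open edge with exactly one end in \<open>X\<close> is
  swapped although its outer end is not; by \<open>cross\<close> that end is posted, also after the
  swap, so its two copies are linked and the gap closes.\<close>

lemma linked_flip_conf:
  assumes S: "S \<subseteq> bb_edges"
    and cross: "\<And>e x y. e \<in> edges G \<Longrightarrow> e \<in> singly S \<Longrightarrow> ends G e = Upair x y \<Longrightarrow> x \<in> X \<Longrightarrow> y \<notin> X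
      \<Longrightarrow> y \<in> posted S"
    and ab: "(a, b) \<in> linked S"
  shows "(flip_vertex X a, flip_vertex X b) \<in> linked (flip_conf X S)"
  using ab unfolding linked_def
proof (induction rule: rtrancl_induct)
  case (step b c)
  let ?L = "linked (flip_conf X S)"
  obtain x i y j where b: "b = (x, i)" and c: "c = (y, j)" by (cases b, cases c)
  have post: "((w, k), (w, l)) \<in> ?L" if "w \<in> posted S" "k \<in> {0, 1}" "l \<in> {0, 1}" for w k l
    using that by (intro linked_posted flip_conf_subset) (simp_all add: posted_flip_conf[OF S])
  have "(flip_vertex X b, flip_vertex X c) \<in> ?L"
    using step.hyps(2) unfolding b c adjacency_bunkbed_iff
  proof (elim disjE conjE bexE)
    fix e assume e: "i = j" "i \<in> {0, 1}" "e \<in> edges G" "Horizontal e i \<in> S" "ends G e = Upair x y"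
    let ?i = "if e \<in> touching X then 1 - i else i"
    have "Horizontal e ?i \<in> flip_conf X S" using e by (auto simp: flip_conf_def)
    then have link: "((x, ?i), (y, ?i)) \<in> ?L" using e by (intro linked_edge) auto
    have t: "e \<in> touching X \<longleftrightarrow> x \<in> X \<or> y \<in> X" using e by (auto simp: touching_def)
    have s: "e \<in> singly S" using e by (auto simp: singly_def)
    have i: "1 - i \<in> {0, 1}" using e by auto
    consider "x \<in> X \<longleftrightarrow> y \<in> X" | "x \<in> X" "y \<notin> X" | "x \<notin> X" "y \<in> X" by blast
    then show "(flip_vertex X (x, i), flip_vertex X (y, j)) \<in> ?L"
    proof cases
      case 1
      then show ?thesis using link e(1) t by (auto simp: flip_vertex_def)
    next
      case 2
      have "((y, 1 - i), (y, i)) \<in> ?L"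
        using cross[OF e(3) s e(5) 2] i e(2) by (rule post)
      moreover have "((x, 1 - i), (y, 1 - i)) \<in> ?L" using link 2 t by simp
      ultimately have "((x, 1 - i), (y, i)) \<in> ?L" by (rule linked_trans[rotated])
      then show ?thesis using 2 e(1) by (simp add: flip_vertex_def)
    next
      case 3
      have "ends G e = Upair y x" using e by simp
      then have "((x, i), (x, 1 - i)) \<in> ?L"
        using cross[OF e(3) s _ 3(2) 3(1)] i e(2) by (intro post) auto
      moreover have "((x, 1 - i), (y, 1 - i)) \<in> ?L" using link 3 t by simp
      ultimately have "((x, i), (y, 1 - i)) \<in> ?L" by (rule linked_trans)
      then show ?thesis using 3 e(1) by (simp add: flip_vertex_def)
    qed
  next
    assume h: "x = y" "x \<in> verts G" "Vertical x \<in> S" "(i, j) \<in> {(0, 1), (1, 0)}"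
    then have "((x, i), (x, j)) \<in> adjacency (bunkbed G) (flip_conf X S)"
         "((x, j), (x, i)) \<in> adjacency (bunkbed G) (flip_conf X S)"
      by (auto simp: adjacency_bunkbed_iff flip_conf_def)
    then show "(flip_vertex X (x, i), flip_vertex X (y, j)) \<in> ?L"
      using h by (auto simp: flip_vertex_def linked_def)
  qed
  with step.IH show ?case unfolding linked_def by (rule rtrancl_trans)
qed simp

section \<open>Structure of the region and the opening map\<close>

definition level :: "nat \<Rightarrow> ('v, 'e) bb_edge set \<Rightarrow> 'e set" where
  "level i S = {e. Horizontal e i \<in> S}"

definition full :: "nat \<Rightarrow> ('v, 'e) bb_edge set \<Rightarrow> bool" where
  "full i S \<longleftrightarrow> inner_edges (region S) \<subseteq> level i S"

text \<open>Boundary edges of the region are never open on both levels, so for them membership in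
  \<open>singly\<close> forgets only the level, and each has as many open copies in \<open>opened S\<close> as in \<open>S\<close>.\<close>

definition opened :: "('v, 'e) bb_edge set \<Rightarrow> ('v, 'e) bb_edge set" where
  "opened S = {b \<in> bb_edges. case b of
     Horizontal e i \<Rightarrow>
       if e \<in> inner_edges (region S) then True
       else if e \<in> rim_edges (region S) then i = 0 \<and> e \<in> singly S
       else b \<in> S
   | Vertical w \<Rightarrow> b \<in> S}"

lemma finite_edges: "finite (edges G)"
  using finite_graph by (simp add: finite_graph_def)

lemma adjacencyI: "e \<in> edges G \<Longrightarrow> e \<in> F \<Longrightarrow> ends G e = Upair x y \<Longrightarrow> (x, y) \<in> adjacency G F"
  by (auto simp: adjacency_def)

lemma region_not_posted: "x \<in> region S \<Longrightarrow> x \<notin> posted S"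
  unfolding region_def by (auto elim: rtranclE)

lemma root_in_region: "x \<in> region S \<Longrightarrow> v \<in> region S"
  by (simp add: region_def)

lemma region_closed:
  assumes "x \<in> region S" "e \<in> edges G" "e \<in> singly S" "ends G e = Upair x y" "y \<notin> posted S"
  shows "y \<in> region S"
proof -
  have "(x, y) \<in> Restr (adjacency G (singly S)) (- posted S)"
    using assms adjacencyI region_not_posted by auto
  then show ?thesis using assms(1) unfolding region_def by (auto intro: rtrancl_into_rtrancl)
qed

text \<open>If the other end were posted, extending its doubly open path by \<open>e\<close> would
  post \<open>x\<close> as well. Hence no boundary edge is open on both levels.\<close>

lemma region_doubly:
  assumes "x \<in> region S" "e \<in> edges G" "e \<in> doubly S" "ends G e = Upair x y"
  shows "y \<in> region S"
proof (rule region_closed[OF assms(1,2) _ assms(4)])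
  show "e \<in> singly S" using assms(3) by (simp add: doubly_def singly_def)
  have xy: "(x, y) \<in> adjacency G (doubly S)" using assms by (intro adjacencyI)
  show "y \<notin> posted S"
  proof
    assume "y \<in> posted S"
    then have "x \<in> posted S"
      using xy unfolding posted_def by (auto intro: converse_rtrancl_into_rtrancl)
    then show False using region_not_posted[OF assms(1)] by simp
  qed
qed

lemma vertical_posted: "Vertical w \<in> S \<Longrightarrow> w \<in> posted S"
  unfolding posted_def by auto

lemma ends_in_verts: "e \<in> edges G \<Longrightarrow> ends G e = Upair x y \<Longrightarrow> x \<in> verts G \<and> y \<in> verts G"
  using multigraph by (force simp: multigraph_def)

text \<open>Every vertex on a path witnessing membership in the region lies in the region itself, so
  the path uses inner edges only.\<close>

lemma region_connected:
  assumes "x \<in> region S"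
  shows "(v, x) \<in> (adjacency G (singly S \<inter> inner_edges (region S)))\<^sup>*"
proof -
  have v: "v \<notin> posted S" and "(v, x) \<in> (Restr (adjacency G (singly S)) (- posted S))\<^sup>*"
    using assms by (simp_all add: region_def)
  from this(2) show ?thesis
  proof (induction rule: rtrancl_induct)
    case (step y z)
    have "(v, z) \<in> (Restr (adjacency G (singly S)) (- posted S))\<^sup>*"
      using step.hyps by (rule rtrancl_into_rtrancl)
    then have yz: "y \<in> region S" "z \<in> region S" using step.hyps(1) v by (simp_all add: region_def)
    obtain e where e: "e \<in> edges G" "e \<in> singly S" "ends G e = Upair y z"
      using step.hyps(2) by (auto simp: adjacency_def)
    then have "(y, z) \<in> adjacency G (singly S \<inter> inner_edges (region S))"
      using yz by (intro adjacencyI) (auto simp: inner_edges_def)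
    with step.IH show ?case by (rule rtrancl_into_rtrancl)
  qed simp
qed

text \<open>Closedness keeps paths that avoid posted vertices from leaving \<open>X\<close>;
  conversely, paths of inner edges meet no posted vertex. This identifies the region after
  \<open>opened\<close>, and later in an explicit configuration.\<close>

lemma region_eqI:
  assumes v: "v \<in> X" and np: "X \<inter> posted S = {}"
    and closed: "\<And>e x y. e \<in> edges G \<Longrightarrow> e \<in> singly S \<Longrightarrow> ends G e = Upair x y \<Longrightarrow> x \<in> X \<Longrightarrow> y \<notin> X
      \<Longrightarrow> y \<in> posted S"
    and conn: "\<And>x. x \<in> X \<Longrightarrow> (v, x) \<in> (adjacency G (singly S \<inter> inner_edges X))\<^sup>*"
  shows "region S = X"
proof
  show "region S \<subseteq> X"
  proof
    fix x assume "x \<in> region S"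
    then have "(v, x) \<in> (Restr (adjacency G (singly S)) (- posted S))\<^sup>*" by (simp add: region_def)
    then show "x \<in> X"
    proof (induction rule: rtrancl_induct)
      case (step y z)
      then obtain e where "e \<in> edges G" "e \<in> singly S" "ends G e = Upair y z"
        by (auto simp: adjacency_def)
      with step closed show ?case by blast
    qed (rule v)
  qed
  have "adjacency G (singly S \<inter> inner_edges X) \<subseteq> Restr (adjacency G (singly S)) (- posted S)"
  proof
    fix a assume "a \<in> adjacency G (singly S \<inter> inner_edges X)"
    then obtain x y e where "a = (x, y)" "e \<in> edges G" "e \<in> singly S" "e \<in> inner_edges X"
        "ends G e = Upair x y"
      by (auto simp: adjacency_def)
    then show "a \<in> Restr (adjacency G (singly S)) (- posted S)"
      using np by (auto simp: inner_edges_def intro: adjacencyI)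
  qed
  then show "X \<subseteq> region S"
    using conn v np rtrancl_mono unfolding region_def by blast
qed

text \<open>The path of inner edges from \<open>v\<close> to \<open>x\<close> lifts to level
  \<open>i\<close>, where all of them are open.\<close>

lemma linked_full:
  assumes "x \<in> region S" "full i S" "i \<in> {0, 1}"
  shows "((v, i), (x, i)) \<in> linked S"
  using region_connected[OF assms(1)] assms(3)
  by (rule linked_level) (use assms(2) in \<open>auto simp: full_def level_def\<close>)

lemma opened_subset: "opened S \<subseteq> bb_edges"
  by (auto simp: opened_def)

lemma opened_iff:
  "Vertical w \<in> opened S \<longleftrightarrow> w \<in> verts G \<and> Vertical w \<in> S"
  "Horizontal e i \<in> opened S \<longleftrightarrow> e \<in> edges G \<and> (i = 0 \<or> i = 1) \<and>
     (if e \<in> inner_edges (region S) then True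
      else if e \<in> rim_edges (region S) then i = 0 \<and> e \<in> singly S
      else Horizontal e i \<in> S)"
  by (auto simp: opened_def)

lemma rim_edges_iff:
  assumes "e \<in> edges G" "ends G e = Upair x y"
  shows "e \<in> inner_edges X \<longleftrightarrow> x \<in> X \<and> y \<in> X" "e \<in> rim_edges X \<longleftrightarrow> (x \<in> X \<longleftrightarrow> y \<notin> X)"
  using assms by (auto simp: inner_edges_def rim_edges_def touching_def)

lemma not_doubly_rim: "e \<in> rim_edges (region S) \<Longrightarrow> e \<notin> doubly S"
proof
  assume e: "e \<in> rim_edges (region S)" "e \<in> doubly S"
  obtain x y where xy: "ends G e = Upair x y" by (cases "ends G e")
  then have yx: "ends G e = Upair y x" by simp
  have "e \<in> edges G" using e by (simp add: rim_edges_def touching_def)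
  then show False
    using region_doubly[OF _ _ e(2) xy] region_doubly[OF _ _ e(2) yx] rim_edges_iff(2)[OF _ xy] e by blast
qed

text \<open>Boundary edges are doubly open neither before nor after opening, so doubly open paths
  stay on one side of the boundary. Inside there is no open vertical edge, hence still no posted
  vertex; outside the paths survive, so a posted neighbour across the boundary remains
  posted.\<close>

lemma region_opened:
  assumes S: "S \<subseteq> bb_edges" and v: "v \<in> region S"
  shows "region (opened S) = region S"
proof (rule region_eqI)
  let ?X = "region S" and ?T = "opened S"
  show "v \<in> ?X" by fact
  have nd: "e \<notin> doubly ?T" if "e \<in> rim_edges ?X" for e
    using that by (auto simp: doubly_def opened_iff rim_edges_def)
  show "?X \<inter> posted ?T = {}"
  proof (rule ccontr)
    assume "?X \<inter> posted ?T \<noteq> {}"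
    then obtain x w where x: "x \<in> ?X" "(x, w) \<in> (adjacency G (doubly ?T))\<^sup>*" "Vertical w \<in> ?T"
      by (auto simp: posted_def)
    from x(2,1) have "w \<in> ?X"
    proof (induction rule: rtrancl_induct)
      case (step y z)
      then obtain e where e: "e \<in> edges G" "e \<in> doubly ?T" "ends G e = Upair y z"
        by (auto simp: adjacency_def)
      then show ?case using nd rim_edges_iff(2)[OF e(1,3), of ?X] step by blast
    qed
    then show False using x(3) region_not_posted vertical_posted by (auto simp: opened_iff)
  qed
  show "y \<in> posted ?T"
    if e: "e \<in> edges G" "e \<in> singly ?T" "ends G e = Upair x y" and "x \<in> ?X" "y \<notin> ?X" for e x y
  proof -
    have "e \<in> rim_edges ?X" using that rim_edges_iff(2) by blast
    then have "e \<in> singly S" using e by (auto simp: singly_def opened_iff rim_edges_def)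
    then have "y \<in> posted S" using that region_closed by blast
    then obtain w where w: "(y, w) \<in> (adjacency G (doubly S))\<^sup>*" "Vertical w \<in> S"
      by (auto simp: posted_def)
    from w(1) have "w \<notin> ?X \<and> (y, w) \<in> (adjacency G (doubly ?T))\<^sup>*"
    proof (induction rule: rtrancl_induct)
      case base
      then show ?case using \<open>y \<notin> ?X\<close> by simp
    next
      case (step a b)
      then obtain f where f: "f \<in> edges G" "f \<in> doubly S" "ends G f = Upair a b"
        by (auto simp: adjacency_def)
      have "f \<notin> rim_edges ?X" using f(2) not_doubly_rim by blast
      then have "b \<notin> ?X" and "f \<notin> inner_edges ?X" using step rim_edges_iff[OF f(1,3), of ?X] by auto
      moreover have "f \<in> doubly ?T"
        using f \<open>f \<notin> rim_edges ?X\<close> \<open>f \<notin> inner_edges ?X\<close> by (simp add: doubly_def opened_iff)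
      ultimately show ?case
        using step f adjacencyI by (meson rtrancl_into_rtrancl)
    qed
    moreover have "Vertical w \<in> ?T" using w(2) S by (auto simp: opened_iff)
    ultimately show ?thesis by (auto simp: posted_def)
  qed
  show "(v, x) \<in> (adjacency G (singly ?T \<inter> inner_edges ?X))\<^sup>*" if "x \<in> ?X" for x
  proof -
    have "adjacency G (singly S \<inter> inner_edges ?X) \<subseteq> adjacency G (singly ?T \<inter> inner_edges ?X)"
      by (auto simp: adjacency_def singly_def opened_iff)
    then show ?thesis using region_connected[OF that] rtrancl_mono by blast
  qed
qed

lemma full_opened:
  assumes "S \<subseteq> bb_edges" "v \<in> region S" "i \<in> {0, 1}"
  shows "full i (opened S)"
  using assms(3) unfolding full_def region_opened[OF assms(1,2)]
  by (auto simp: level_def opened_iff inner_edges_def)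

text \<open>After opening, the boundary edges are closed on level 1 and no vertical edge at the
  region is open, so the cluster of \<open>(v, 1)\<close> cannot leave the level 1 copy of the
  region.\<close>

lemma not_linked_opened:
  assumes "S \<subseteq> bb_edges" "v \<in> region S"
  shows "((u, 0), (v, 1)) \<notin> linked (opened S)"
proof
  let ?X = "region S"
  assume "((u, 0), (v, 1)) \<in> linked (opened S)"
  then have "((v, 1), (u, 0)) \<in> linked (opened S)" by (rule linked_sym)
  then have "(u, 0::nat) \<in> ?X \<times> {1}"
    unfolding linked_def
  proof (induction rule: rtrancl_induct)
    case base
    then show ?case using assms by simp
  next
    case (step a b)
    then obtain x where a: "a = (x, 1)" "x \<in> ?X" by auto
    obtain y j where b: "b = (y, j)" by (cases b)
    from step.hyps(2) show ?case
      unfolding a b adjacency_bunkbed_iff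
    proof (elim disjE conjE bexE)
      fix e assume e: "1 = j" "e \<in> edges G" "Horizontal e 1 \<in> opened S" "ends G e = Upair x y"
      then have "e \<notin> rim_edges ?X" by (auto simp: opened_iff rim_edges_def split: if_splits)
      then show "(y, j) \<in> ?X \<times> {1}" using a e rim_edges_iff(2) by blast
    next
      assume "Vertical x \<in> opened S"
      then show "(y, j) \<in> ?X \<times> {1}"
        using a region_not_posted vertical_posted by (auto simp: opened_iff)
    qed
  qed
  then show False by simp
qed

section \<open>Weights of the fibres of the opening map\<close>

text \<open>Grouping the two copies of each edge of \<open>G\<close> allows configurations to be
  compared edge by edge; moving an edge to the other level leaves its factor unchanged.\<close>

lemma weight_levels:
  "bernoulli_weight p bb_edges S =
     (\<Prod>w\<in>verts G. if Vertical w \<in> S then p else 1 - p) *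
     (\<Prod>e\<in>edges G. (if e \<in> level 0 S then p else 1 - p) * (if e \<in> level 1 S then p else 1 - p))"
proof -
  let ?h = "\<lambda>b. if b \<in> S then p else 1 - p"
  have fin: "finite (verts G)" "finite (edges G)" using finite_graph by (simp_all add: finite_graph_def)
  let ?H = "\<lambda>i. (\<lambda>e. Horizontal e i) ` edges G"
  have "bb_edges = Vertical ` verts G \<union> (?H 0 \<union> ?H 1)"
    by (auto simp: bunkbed_def)
  moreover have "prod ?h (Vertical ` verts G \<union> (?H 0 \<union> ?H 1))
      = prod ?h (Vertical ` verts G) * prod ?h (?H 0 \<union> ?H 1)"
    using fin by (intro prod.union_disjoint) auto
  moreover have "prod ?h (?H 0 \<union> ?H 1) = prod ?h (?H 0) * prod ?h (?H 1)"
    using fin by (intro prod.union_disjoint) auto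
  ultimately have "bernoulli_weight p bb_edges S =
      prod ?h (Vertical ` verts G) * (prod ?h (?H 0) * prod ?h (?H 1))"
    by (simp only: bernoulli_weight_def)
  also have "\<dots> = (\<Prod>w\<in>verts G. ?h (Vertical w)) *
      ((\<Prod>e\<in>edges G. ?h (Horizontal e 0)) * (\<Prod>e\<in>edges G. ?h (Horizontal e 1)))"
    by (simp add: prod.reindex inj_on_def)
  finally show ?thesis by (simp add: level_def prod.distrib)
qed

text \<open>A boundary edge keeps its number of open copies, and edges away from the region and
  vertical edges are untouched. So only the factors of the inner edges change, and they all become
  \<open>p\<close>.\<close>

lemma weight_opened:
  fixes p :: real
  assumes S: "S \<subseteq> bb_edges" and v: "v \<in> region S"
  defines "I \<equiv> inner_edges (region S)"
  shows "bernoulli_weight p bb_edges S * (p ^ card I)\<^sup>2 =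
     bernoulli_weight p bb_edges (opened S) *
       (bernoulli_weight p I (level 0 S \<inter> I) * bernoulli_weight p I (level 1 S \<inter> I))"
proof -
  let ?h = "\<lambda>i S e. if e \<in> level i S then p else 1 - p"
  let ?k = "\<lambda>S e. ?h 0 S e * ?h 1 S e"
  have I: "I \<subseteq> edges G" by (auto simp: I_def inner_edges_def)
  have split: "(\<Prod>e\<in>edges G. ?k T e) = (\<Prod>e\<in>edges G - I. ?k T e) * (\<Prod>e\<in>I. ?k T e)" for T
    by (rule prod.subset_diff[OF I finite_edges])
  have 1: "(\<Prod>e\<in>I. ?k (opened S) e) = (p ^ card I)\<^sup>2"
  proof -
    have "(\<Prod>e\<in>I. ?k (opened S) e) = (\<Prod>e\<in>I. p * p)"
      using I by (intro prod.cong) (auto simp: level_def opened_iff I_def[symmetric])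
    then show ?thesis by (simp add: power2_eq_square power_mult_distrib)
  qed
  have 2: "(\<Prod>e\<in>I. ?k S e) = bernoulli_weight p I (level 0 S \<inter> I) * bernoulli_weight p I (level 1 S \<inter> I)"
    by (simp add: bernoulli_weight_def prod.distrib)
  have 3: "(\<Prod>e\<in>edges G - I. ?k (opened S) e) = (\<Prod>e\<in>edges G - I. ?k S e)"
  proof (rule prod.cong[OF refl])
    fix e assume e: "e \<in> edges G - I"
    show "?k (opened S) e = ?k S e"
    proof (cases "e \<in> rim_edges (region S)")
      case True
      then have "e \<notin> doubly S" by (rule not_doubly_rim)
      then show ?thesis
        using True e by (auto simp: level_def opened_iff I_def doubly_def singly_def)
    next
      case False
      then show ?thesis using e by (simp add: level_def opened_iff I_def)
    qed
  qed
  have 4: "(\<Prod>w\<in>verts G. if Vertical w \<in> opened S then p else 1 - p) =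
      (\<Prod>w\<in>verts G. if Vertical w \<in> S then p else 1 - p)"
    by (intro prod.cong) (auto simp: opened_iff)
  show ?thesis
    unfolding weight_levels split 1 2 3 4 by (simp only: mult_ac)
qed

text \<open>A configuration in the fibre is determined by the inner edges open on each level, two
  proper subsets of \<open>I\<close>, and by the boundary edges open on level 0. Each proper subset
  contributes a factor \<open>1 - p ^ m\<close> to the sum and the boundary at most
  \<open>2 ^ card R\<close>, which leads to \<open>fibre_constant\<close>.\<close>

lemma fibre_weight:
  fixes p :: real
  assumes p: "1 - 2 powr (- real (card (edges G)) / 2 - 2) \<le> p" "p < 1" "0 < p"
  shows "(\<Sum>S | S \<subseteq> bb_edges \<and> v \<in> region S \<and> \<not> full 0 S \<and> \<not> full 1 S \<and> opened S = T.
            bernoulli_weight p bb_edges S) \<le> bernoulli_weight p bb_edges T / 2"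
    (is "sum ?w ?F \<le> _")
proof -
  define I where "I = inner_edges (region T)"
  define R where "R = rim_edges (region T)"
  define m where "m = card I"
  let ?g = "bernoulli_weight p I"
  let ?\<psi> = "\<lambda>S. (level 0 S \<inter> I, level 1 S \<inter> I, level 0 S \<inter> R)"
  let ?P = "Pow I - {I}"
  let ?C = "?P \<times> ?P \<times> Pow R"
  let ?f = "\<lambda>(a, b, c). ?w T * (?g a * ?g b) / (p ^ m)\<^sup>2"
  have sub: "I \<subseteq> edges G" "R \<subseteq> edges G" "I \<inter> R = {}"
    by (auto simp: I_def R_def inner_edges_def rim_edges_def touching_def)
  then have fin: "finite I" "finite R" using finite_edges finite_subset by blast+
  have "m + card R = card (I \<union> R)" using fin sub by (simp add: m_def card_Un_disjoint)
  also have "\<dots> \<le> card (edges G)" using sub finite_edges by (intro card_mono) auto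
  finally have const: "2 * (2 ^ card R * (1 - p ^ m)\<^sup>2) \<le> (p ^ m)\<^sup>2"
    using fibre_constant[OF p(1,2)] by blast
  have pm: "(p ^ m)\<^sup>2 > 0" using p by simp
  have wT: "0 \<le> ?w T" using p by (intro bernoulli_weight_nonneg) auto
  \<comment> \<open>Opening preserves the region, so \<open>I\<close> and \<open>R\<close>, though
    defined from \<open>T\<close>, are the inner and boundary edges of every \<open>S\<close> in the
    fibre.\<close>
  have reg: "region S = region T" if "S \<in> ?F" for S
    using that region_opened by auto
  have "inj_on ?\<psi> ?F"
  proof (rule inj_onI)
    fix S S' assume S: "S \<in> ?F" and S': "S' \<in> ?F" and eq: "?\<psi> S = ?\<psi> S'"
    have *: "b \<in> A'" if A: "A \<in> ?F" "A' \<in> ?F" "?\<psi> A = ?\<psi> A'" and b: "b \<in> A" for A A' b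
    proof -
      have r: "region A = region T" "region A' = region T" using reg[OF A(1)] reg[OF A(2)] by simp_all
      have o: "opened A = T" "opened A' = T" and AE: "A \<subseteq> bb_edges" using A by auto
      show ?thesis
      proof (cases b)
        case (Vertical w)
        then have "b \<in> opened A" using b AE by (auto simp: opened_iff)
        then have "b \<in> opened A'" using o by simp
        then show ?thesis using Vertical by (simp add: opened_iff)
      next
        case (Horizontal e i)
        then have e: "e \<in> edges G" "i = 0 \<or> i = 1" using b AE by auto
        consider "e \<in> I" | "e \<in> R" | "e \<notin> I" "e \<notin> R" by blast
        then show ?thesis
        proof cases
          case 1
          then show ?thesis using A(3) e b Horizontal by (auto simp: level_def set_eq_iff)
        next
          case 2
          \<comment> \<open>\<open>T\<close> records only that \<open>e\<close> is open on some
            level; the third coordinate tells which, as it is not open on both.\<close>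
          have l0: "e \<in> level 0 A \<longleftrightarrow> e \<in> level 0 A'" using A(3) 2 by (auto simp: set_eq_iff)
          have "e \<notin> doubly A" using not_doubly_rim 2 r by (simp add: R_def)
          have nI: "e \<notin> inner_edges (region T)" "e \<in> rim_edges (region T)" using 2 sub by (auto simp: I_def R_def)
          have "Horizontal e 0 \<in> opened A" 
            using e b Horizontal nI r by (auto simp: opened_iff singly_def)
          then have "Horizontal e 0 \<in> opened A'" using o by simp
          then have "e \<in> singly A'" using nI r by (simp add: opened_iff)
          then show ?thesis
            using l0 e b Horizontal \<open>e \<notin> doubly A\<close> by (auto simp: level_def doubly_def singly_def)
        next
          case 3
          then have "b \<in> opened A" using e b Horizontal r by (auto simp: opened_iff I_def R_def)
          then have "b \<in> opened A'" using o by simp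
          then show ?thesis using Horizontal 3 r by (simp add: opened_iff I_def R_def)
        qed
      qed
    qed
    show "S = S'" using *[OF S S' eq] *[OF S' S eq[symmetric]] by blast
  qed
  moreover have "?\<psi> ` ?F \<subseteq> ?C"
  proof (rule image_subsetI)
    fix S assume S: "S \<in> ?F"
    \<comment> \<open>Failure of fullness on both levels is what excludes \<open>I\<close> from the
      first two coordinates.\<close>
    then have "\<not> I \<subseteq> level 0 S" "\<not> I \<subseteq> level 1 S"
      using reg[OF S] by (auto simp: full_def I_def)
    then show "?\<psi> S \<in> ?C" by auto
  qed
  moreover have "?w S = ?f (?\<psi> S)" if "S \<in> ?F" for S
  proof -
    have "?w S * (p ^ m)\<^sup>2 = ?w T * (?g (level 0 S \<inter> I) * ?g (level 1 S \<inter> I))"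
      using weight_opened[of S p] that reg[OF that] by (simp add: I_def m_def)
    then show ?thesis using pm by (simp add: eq_divide_eq)
  qed
  then have "sum ?w ?F = (\<Sum>S\<in>?F. ?f (?\<psi> S))"
    by (rule sum.cong[OF refl])
  ultimately have "sum ?w ?F = sum ?f (?\<psi> ` ?F)"
    by (simp only: sum.reindex o_def)
  also have "\<dots> \<le> sum ?f ?C"
  proof (rule sum_mono2)
    show "finite ?C" using fin by simp
    show "?\<psi> ` ?F \<subseteq> ?C" by fact
    have "0 \<le> ?g a" for a using p by (intro bernoulli_weight_nonneg) auto
    then show "0 \<le> ?f x" for x using wT by (cases x) simp
  qed
  also have "\<dots> = (\<Sum>a\<in>?P. \<Sum>b\<in>?P. \<Sum>c\<in>Pow R. ?w T * (?g a * ?g b) / (p ^ m)\<^sup>2)"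
    by (simp only: sum.cartesian_product)
  also have "\<dots> = (\<Sum>a\<in>?P. \<Sum>b\<in>?P. ?g a * ?g b) * (?w T / (p ^ m)\<^sup>2 * 2 ^ card R)"
    unfolding sum_distrib_right using fin by (intro sum.cong refl) (simp add: card_Pow)
  also have "\<dots> = ?w T / (p ^ m)\<^sup>2 * ((\<Sum>a\<in>?P. ?g a) * (\<Sum>a\<in>?P. ?g a) * 2 ^ card R)"
    by (simp only: sum_product[symmetric]) (simp only: mult_ac)
  also have "(\<Sum>a\<in>?P. ?g a) = 1 - p ^ m"
    unfolding m_def by (rule sum_bernoulli_weight_not_all[OF fin(1)])
  also have "?w T / (p ^ m)\<^sup>2 * ((1 - p ^ m) * (1 - p ^ m) * 2 ^ card R) \<le> ?w T / 2"
  proof -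
    have "(1 - p ^ m) * (1 - p ^ m) * 2 ^ card R / (p ^ m)\<^sup>2 \<le> 1 / 2"
      using const pm by (simp add: field_simps power2_eq_square)
    from mult_left_mono[OF this wT] show ?thesis by (simp add: field_simps)
  qed
  finally show ?thesis .
qed

section \<open>Comparison of the two connection events\<close>

lemma bunkbed_prob_eq:
  assumes "0 \<le> p" "p \<le> 1" "u \<in> verts G" "i \<in> {0, 1}"
  shows "bunkbed_prob G p (u, 0) (v, i) =
    (\<Sum>S | S \<subseteq> bb_edges \<and> ((u, 0), (v, i)) \<in> linked S. bernoulli_weight p bb_edges S)"
proof -
  have "joined (bunkbed G) S (u, 0) (v, i) \<longleftrightarrow> ((u, 0), (v, i)) \<in> linked S" for S
    using assms root by (auto simp: joined_def linked_def bunkbed_def)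
  then show ?thesis
    unfolding bunkbed_prob_def percolation_def connection_event_def
    using prob_Pi_bernoulli[OF finite_bb_edges assms(1,2), of "\<lambda>S. ((u, 0), (v, i)) \<in> linked S"]
    by simp
qed

text \<open>The two swaps give weak inequalities between disjoint pieces. Strictness comes from the
  factor 1/2 in the opening map, once \<open>B3\<close> is known to have positive weight.\<close>

lemma bunkbed_prob_less:
  fixes p :: real
  assumes p: "1 - 2 powr (- real (card (edges G)) / 2 - 2) \<le> p" "p < 1" and u: "u \<in> verts G"
  shows "bunkbed_prob G p (u, 0) (v, 1) < bunkbed_prob G p (u, 0) (v, 0)"
proof -
  have "(2::real) powr (- real (card (edges G)) / 2 - 2) < 2 powr 0"
    by (intro powr_less_mono) auto
  then have p0: "0 < p" using p(1) by simp
  define A where "A = {S. S \<subseteq> bb_edges \<and> ((u, 0), (v, 1)) \<in> linked S \<and> ((u, 0), (v, 0)) \<notin> linked S}"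
  define B where "B = {S. S \<subseteq> bb_edges \<and> ((u, 0), (v, 0)) \<in> linked S \<and> ((u, 0), (v, 1)) \<notin> linked S}"
  let ?w = "bernoulli_weight p bb_edges"
  have w0: "0 \<le> ?w S" for S using p p0 by (intro bernoulli_weight_nonneg) auto
  have finP: "finite {S. S \<subseteq> bb_edges \<and> Q S}" for Q
    using finite_bb_edges by (auto intro: finite_subset[of _ "Pow bb_edges"])
  have fin: "finite A" "finite B" unfolding A_def B_def by (rule finP)+
  define A1 where "A1 = {S \<in> A. u \<notin> region S}"
  define A2 where "A2 = {S \<in> A. u \<in> region S \<and> full 1 S \<and> \<not> full 0 S}"
  define A3 where "A3 = {S \<in> A. u \<in> region S \<and> \<not> full 1 S \<and> \<not> full 0 S}"
  define B1 where "B1 = {S \<in> B. u \<notin> region S}"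
  \<comment> \<open>Fullness on level 1 separates \<open>B2\<close> from \<open>B3\<close>, so the
    second swap and the opening map have disjoint targets.\<close>
  define B2 where "B2 = {S \<in> B. u \<in> region S \<and> full 0 S \<and> \<not> full 1 S}"
  define B3 where "B3 = {S \<in> B. u \<in> region S \<and> full 0 S \<and> full 1 S}"
  have finAB: "finite A1" "finite A2" "finite A3" "finite B1" "finite B2" "finite B3"
    using fin by (simp_all add: A1_def A2_def A3_def B1_def B2_def B3_def)

  have le1: "sum ?w A1 \<le> sum ?w B1"
  proof (rule sum_le_sum_inj)
    let ?f = "\<lambda>S. flip_conf (region S) S"
    show "inj_on ?f A1"
    proof (rule inj_on_inverseI)
      fix S assume "S \<in> A1"
      then have "S \<subseteq> bb_edges" by (simp add: A1_def A_def)
      then show "?f (?f S) = S" by (simp add: region_flip_conf flip_conf_flip_conf)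
    qed
    show "?f ` A1 \<subseteq> B1"
    proof (rule image_subsetI)
      fix S assume "S \<in> A1"
      then have S: "S \<subseteq> bb_edges" and l: "((u, 0), (v, 1)) \<in> linked S" "((u, 0), (v, 0)) \<notin> linked S"
        and ux: "u \<notin> region S" by (auto simp: A1_def A_def)
      let ?X = "region S"
      \<comment> \<open>In \<open>A\<close> the two copies of \<open>v\<close> lie in different
        clusters, so \<open>v\<close> is not posted and the region is not empty.\<close>
      have "((v, 1), (v, 0)) \<notin> linked S" using l linked_trans by blast
      then have "v \<notin> posted S" using linked_posted[OF _ S, of v 1 0] by auto
      then have vx: "v \<in> ?X" by (simp add: region_def)
      have cross: "y \<in> posted S" if "e \<in> edges G" "e \<in> singly S" "ends G e = Upair x y" "x \<in> ?X" "y \<notin> ?X"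
        for e x y
        using that region_closed by blast
      have flip: "(flip_vertex ?X a, flip_vertex ?X b) \<in> linked (?f S)" if "(a, b) \<in> linked S" for a b
        using S cross that by (rule linked_flip_conf)
      have unflip: "(flip_vertex ?X a, flip_vertex ?X b) \<in> linked S" if "(a, b) \<in> linked (?f S)" for a b
      proof -
        have "(flip_vertex ?X a, flip_vertex ?X b) \<in> linked (flip_conf ?X (?f S))"
          by (rule linked_flip_conf[OF flip_conf_subset _ that])
             (use cross singly_flip_conf[OF S] posted_flip_conf[OF S] in auto)
        then show ?thesis by (simp add: flip_conf_flip_conf[OF S])
      qed
      have "((u, 0), (v, 0)) \<in> linked (?f S)" using flip[OF l(1)] ux vx by (simp add: flip_vertex_def)
      moreover have "((u, 0), (v, 1)) \<notin> linked (?f S)"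
        using unflip[of "(u, 0)" "(v, 1)"] l(2) ux vx by (auto simp: flip_vertex_def)
      ultimately show "?f S \<in> B1"
        using ux by (simp add: B1_def B_def flip_conf_subset region_flip_conf[OF S])
    qed
    show "?w (?f S) = ?w S" if "S \<in> A1" for S
      using that by (intro weight_flip_conf) (simp add: A1_def A_def)
  qed (use w0 finAB in auto)

  have le2: "sum ?w A2 \<le> sum ?w B2"
  proof (rule sum_le_sum_inj)
    \<comment> \<open>With all vertices chosen, every edge is swapped and the crossing condition
      holds vacuously.\<close>
    let ?V = "verts G"
    let ?f = "flip_conf ?V"
    show "inj_on ?f A2"
      by (rule inj_on_inverseI[of _ ?f]) (auto simp: A2_def A_def flip_conf_flip_conf)
    show "?f ` A2 \<subseteq> B2"
    proof (rule image_subsetI)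
      fix S assume "S \<in> A2"
      then have S: "S \<subseteq> bb_edges" and l: "((u, 0), (v, 1)) \<in> linked S" "((u, 0), (v, 0)) \<notin> linked S"
        and ux: "u \<in> region S" and full: "full 1 S" "\<not> full 0 S" by (auto simp: A2_def A_def)
      have flip: "(flip_vertex ?V a, flip_vertex ?V b) \<in> linked (?f T)"
        if "(a, b) \<in> linked T" "T \<subseteq> bb_edges" for a b T
        by (rule linked_flip_conf[OF that(2) _ that(1)]) (use ends_in_verts in blast)
      have touch: "e \<in> touching ?V" if "e \<in> edges G" for e
        using that ends_in_verts by (cases "ends G e") (auto simp: touching_def)
      have lev: "level 0 (?f S) \<inter> edges G = level 1 S \<inter> edges G"
        "level 1 (?f S) \<inter> edges G = level 0 S \<inter> edges G"
        using touch by (auto simp: level_def flip_conf_def)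
      have inn: "inner_edges (region S) \<subseteq> edges G" by (auto simp: inner_edges_def)
      have full': "full 0 (?f S)" "\<not> full 1 (?f S)"
        using full lev inn unfolding full_def region_flip_conf[OF S] by blast+
      have ux': "u \<in> region (?f S)" using ux by (simp add: region_flip_conf[OF S])
      have "((v, 0), (u, 0)) \<in> linked (?f S)" using linked_full[OF ux' full'(1)] by simp
      then have uv: "((u, 0), (v, 0)) \<in> linked (?f S)" by (rule linked_sym)
      \<comment> \<open>The full swap also moves the start to \<open>(u, 1)\<close>; the link
        \<open>uv\<close> along level 0 carries the conclusion back to
        \<open>(u, 0)\<close>.\<close>
      have "((u, 1), (v, 0)) \<in> linked (?f S)"
        using flip[OF l(1) S] u root by (simp add: flip_vertex_def)
      moreover have "((u, 1), (v, 1)) \<notin> linked (?f S)"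
        using flip[of "(u, 1)" "(v, 1)" "?f S"] flip_conf_subset l(2) u root
        by (auto simp: flip_vertex_def flip_conf_flip_conf[OF S])
      ultimately have "((u, 0), (v, 1)) \<notin> linked (?f S)"
        using uv linked_trans linked_sym by blast
      then show "?f S \<in> B2"
        using uv ux' full' by (simp add: B2_def B_def flip_conf_subset)
    qed
    show "?w (?f S) = ?w S" if "S \<in> A2" for S
      using that by (intro weight_flip_conf) (simp add: A2_def A_def)
  qed (use w0 finAB in auto)

  have opened_B3: "opened S \<in> B3" if "S \<subseteq> bb_edges" "u \<in> region S" for S
  proof -
    have v: "v \<in> region S" using that(2) by (rule root_in_region)
    have ux: "u \<in> region (opened S)" using that by (simp add: region_opened[OF _ v])
    have full: "full 0 (opened S)" "full 1 (opened S)" using that v by (auto intro: full_opened)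
    have "((u, 0), (v, 0)) \<in> linked (opened S)" using linked_full[OF ux full(1)] by (simp add: linked_sym)
    then show ?thesis
      using ux full not_linked_opened[OF that(1) v, of u] by (simp add: B3_def B_def opened_subset)
  qed

  have "sum ?w A3 = (\<Sum>T\<in>B3. \<Sum>S | S \<in> A3 \<and> opened S = T. ?w S)"
    using finAB opened_B3 by (intro sum.group[symmetric]) (auto simp: A3_def A_def)
  also have "\<dots> \<le> (\<Sum>T\<in>B3. ?w T / 2)"
  proof (rule sum_mono)
    fix T
    have "(\<Sum>S | S \<in> A3 \<and> opened S = T. ?w S) \<le>
        (\<Sum>S | S \<subseteq> bb_edges \<and> v \<in> region S \<and> \<not> full 0 S \<and> \<not> full 1 S \<and> opened S = T. ?w S)"
      using w0 by (intro sum_mono2 finP) (auto simp: A3_def A_def intro: root_in_region)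
    also have "\<dots> \<le> ?w T / 2" by (rule fibre_weight[OF p p0])
    finally show "(\<Sum>S | S \<in> A3 \<and> opened S = T. ?w S) \<le> ?w T / 2" .
  qed
  also have "\<dots> = sum ?w B3 / 2" by (simp add: sum_divide_distrib)
  finally have le3: "sum ?w A3 \<le> sum ?w B3 / 2" .

  have "B3 \<noteq> {}"
  proof -
    \<comment> \<open>With all horizontal edges open and all vertical ones closed nothing is posted,
      so connectedness makes the region all of \<open>verts G\<close>.\<close>
    let ?S = "{b \<in> bb_edges. \<forall>w. b \<noteq> Vertical w}"
    have "region ?S = verts G"
    proof (rule region_eqI)
      show "verts G \<inter> posted ?S = {}" by (auto simp: posted_def)
      have "edges G \<subseteq> singly ?S \<inter> inner_edges (verts G)"
        using multigraph by (auto simp: singly_def inner_edges_def multigraph_def)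
      then have "adjacency G (edges G) \<subseteq> adjacency G (singly ?S \<inter> inner_edges (verts G))"
        by (auto simp: adjacency_def)
      then have "(adjacency G (edges G))\<^sup>* \<subseteq> (adjacency G (singly ?S \<inter> inner_edges (verts G)))\<^sup>*"
        by (rule rtrancl_mono)
      then show "(v, x) \<in> (adjacency G (singly ?S \<inter> inner_edges (verts G)))\<^sup>*" if "x \<in> verts G" for x
        using that connected root unfolding connected_graph_def joined_def by blast
    qed (use root ends_in_verts in blast)+
    then have "opened ?S \<in> B3" using u by (intro opened_B3) auto
    then show ?thesis by blast
  qed
  then have "0 < sum ?w B3"
    using finAB p p0 by (intro sum_pos bernoulli_weight_pos) auto

  \<comment> \<open>Fullness on level 0 would join \<open>(u, 0)\<close> to \<open>(v, 0)\<close>;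
    hence the three pieces exhaust \<open>A\<close>.\<close>
  have "\<not> full 0 S" if "S \<in> A" "u \<in> region S" for S
    using linked_full[OF that(2), of 0] that(1) by (auto simp: A_def dest: linked_sym)
  then have "A = A1 \<union> (A2 \<union> A3)" by (auto simp: A1_def A2_def A3_def)
  moreover have "A1 \<inter> (A2 \<union> A3) = {}" "A2 \<inter> A3 = {}" by (auto simp: A1_def A2_def A3_def)
  ultimately have "sum ?w A = sum ?w A1 + (sum ?w A2 + sum ?w A3)"
    using finAB by (simp add: sum.union_disjoint)
  also have "\<dots> < sum ?w B1 + (sum ?w B2 + sum ?w B3)"
    using le1 le2 le3 \<open>0 < sum ?w B3\<close> by simp
  also have "\<dots> = sum ?w (B1 \<union> (B2 \<union> B3))"
  proof -
    have "B1 \<inter> (B2 \<union> B3) = {}" "B2 \<inter> B3 = {}" by (auto simp: B1_def B2_def B3_def)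
    then show ?thesis using finAB by (simp add: sum.union_disjoint)
  qed
  also have "\<dots> \<le> sum ?w B"
    using fin w0 by (intro sum_mono2) (auto simp: B1_def B2_def B3_def)
  finally have AB: "sum ?w A < sum ?w B" .

  \<comment> \<open>Configurations joining \<open>(u, 0)\<close> to both copies of \<open>v\<close>
    contribute equally to the two sides.\<close>
  let ?L = "\<lambda>i. {S. S \<subseteq> bb_edges \<and> ((u, 0), (v, i)) \<in> linked S}"
  have "sum ?w (?L 1) = sum ?w A + sum ?w (?L 0 \<inter> ?L 1)"
    using fin finP
    by (subst sum.union_disjoint[symmetric]) (auto simp: A_def intro!: sum.cong)
  moreover have "sum ?w (?L 0) = sum ?w B + sum ?w (?L 0 \<inter> ?L 1)"
    using fin finP
    by (subst sum.union_disjoint[symmetric]) (auto simp: B_def intro!: sum.cong)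
  ultimately show ?thesis using AB bunkbed_prob_eq[of p u] p p0 u by simp
qed

end

theorem theorem1p2:
  fixes G :: "('v, 'e) mgraph" and p :: real and u v :: 'v
  assumes "multigraph G" and "finite_graph G" and "connected_graph G"
    and "u \<in> verts G" and "v \<in> verts G"
    and "1 - 2 powr (- real (card (edges G)) / 2 - 2) \<le> p" and "p < 1"
  shows "bunkbed_prob G p (u, 0) (v, 0) > bunkbed_prob G p (u, 0) (v, 1)"
proof -
  interpret rooted_graph G v using assms by unfold_locales
  show ?thesis by (rule bunkbed_prob_less) (use assms in auto)
qed

end
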